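(* Let $n\ge0$ be an integer and let $\epsilon$ be a real number such that $\operatorname{Cap}^T(E_0)=\epsilon$ for some closed $E_0\subseteq\partial T$. Then $$\inf\left\{\operatorname{Cap}^T_n(E):\ E\subseteq\partial T\text{ closed},\ \operatorname{Cap}^T(E)=\epsilon\right\}=2^ne_n=\frac{\epsilon}{1-(2-2^{1-n})\epsilon},$$ where the sequence $(e_k)_{k\ge0}$ is defined by $e_0=\epsilon$ and $e_k=\dfrac{e_{k-1}}{2-2e_{k-1}}$ for $k\ge1$.
   Context: $T$ is the infinite rooted dyadic tree with root $o$: every vertex $x$ has exactly two children $x_+,x_-$, and every vertex other than $o$ has exactly one parent. $d(x)$ is the number of edges in the geodesic from $o$ to $x$, so $d(o)=0$; $P(x)=[o,x]$ is the set of vertices on this geodesic, endpoints included. The boundary $\partial T$ is the set of half-infinite geodesics starting at $o$; for $\zeta\in\partial T$, $P(\zeta)$ is the set of vertices of the geodesic $\zeta$. For distinct $\xi,\zeta\in\partial T$, $\xi\wedge\zeta$ is the vertex of largest level $d$ in $P(\xi)\cap P(\zeta)$, and $\partial T$ carries the metric $\rho(\xi,\zeta)=2^{-d(\xi\wedge\zeta)}$ (with $\rho(\xi,\xi)=0$); "closed" refers to this metric. For $\varphi:T\to[0,\infty)$ put $I\varphi(\zeta)=\sum_{x\in P(\zeta)}\varphi(x)$ for $\zeta\in T\cup\partial T$, and $\|\varphi\|_{\ell^2}^2=\sum_{x\in T}\varphi(x)^2$. For closed $E\subseteq\partial T$, $$\operatorname{Cap}^T(E)=\inf\{\|\varphi\|_{\ell^2}^2:\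 \varphi\ge0,\ I\varphi\ge1\text{ on }E\},$$ and for an integer $n\ge1$, $$\operatorname{Cap}^T_n(E)=\inf\{\|\varphi\|_{\ell^2}^2:\ \varphi\ge0,\ I\varphi\ge1\text{ on }E,\ I\varphi(x)=0\ \text{for all }x\in T\text{ with }d(x)=n-1\};$$ also $\operatorname{Cap}^T_0(E)=\operatorname{Cap}^T(E)$. *)

theory Defs
  imports "HOL-Analysis.Analysis" "HOL-Library.Sublist"
begin

text \<open>Vertices are finite words: the root is \<open>[]\<close>, the children of \<open>x\<close> are \<open>x @ [True]\<close> and
  \<open>x @ [False]\<close>, and the level of \<open>x\<close> is \<open>length x\<close>.\<close>

type_synonym vertex = "bool list"

abbreviation level :: "vertex \<Rightarrow> nat" where
  "level x \<equiv> length x"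

definition vpath :: "vertex \<Rightarrow> vertex set" where
  "vpath x = {y. prefix y x}"

text \<open>A half-infinite geodesic from the root is the sequence of its vertices; in a rooted tree
  such a geodesic passes at every step from a vertex to one of its children.\<close>

definition boundary :: "(nat \<Rightarrow> vertex) set" where
  "boundary = {\<zeta>. \<zeta> 0 = [] \<and> (\<forall>k. \<exists>b. \<zeta> (Suc k) = \<zeta> k @ [b])}"

definition bpath :: "(nat \<Rightarrow> vertex) \<Rightarrow> vertex set" where
  "bpath \<zeta> = range \<zeta>"

definition meet :: "(nat \<Rightarrow> vertex) \<Rightarrow> (nat \<Rightarrow> vertex) \<Rightarrow> vertex" where
  "meet \<xi> \<zeta> = (ARG_MAX level x. x \<in> bpath \<xi> \<inter> bpath \<zeta>)"

definition rho :: "(nat \<Rightarrow> vertex) \<Rightarrow> (nat \<Rightarrow> vertex) \<Rightarrow> real" where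
  "rho \<xi> \<zeta> = (if \<xi> = \<zeta> then 0 else 2 powi (- int (level (meet \<xi> \<zeta>))))"

lemma boundary_level:
  assumes "\<zeta> \<in> boundary"
  shows "level (\<zeta> k) = k"
proof (induction k)
  case 0
  then show ?case using assms by (simp add: boundary_def)
next
  case (Suc k)
  obtain b where "\<zeta> (Suc k) = \<zeta> k @ [b]" using assms by (auto simp: boundary_def)
  then show ?case using Suc by simp
qed

lemma boundary_agree_mono:
  assumes "\<xi> \<in> boundary" "\<zeta> \<in> boundary" "\<xi> k = \<zeta> k" "j \<le> k"
  shows "\<xi> j = \<zeta> j"
  using assms(4,3)
proof (induction rule: inc_induct)
  case base
  then show ?case .
next
  case (step i)
  have "\<xi> (Suc i) = \<zeta> (Suc i)" using step by blast
  moreover obtain a where "\<xi> (Suc i) = \<xi> i @ [a]" using assms by (auto simp: boundary_def)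
  moreover obtain b where "\<zeta> (Suc i) = \<zeta> i @ [b]" using assms by (auto simp: boundary_def)
  ultimately show ?case by simp
qed

lemma bpath_Int_iff:
  assumes "\<xi> \<in> boundary" "\<zeta> \<in> boundary"
  shows "x \<in> bpath \<xi> \<inter> bpath \<zeta> \<longleftrightarrow> x = \<xi> (level x) \<and> x = \<zeta> (level x)"
proof
  assume "x \<in> bpath \<xi> \<inter> bpath \<zeta>"
  then obtain i j where "x = \<xi> i" "x = \<zeta> j" unfolding bpath_def by blast
  then show "x = \<xi> (level x) \<and> x = \<zeta> (level x)" using assms boundary_level by metis
next
  assume "x = \<xi> (level x) \<and> x = \<zeta> (level x)"
  then show "x \<in> bpath \<xi> \<inter> bpath \<zeta>" unfolding bpath_def by (metis IntI rangeI)
qed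

lemma meet_props:
  assumes "\<xi> \<in> boundary" "\<zeta> \<in> boundary" "\<xi> \<noteq> \<zeta>"
  shows "meet \<xi> \<zeta> \<in> bpath \<xi> \<inter> bpath \<zeta>"
    and "\<And>x. x \<in> bpath \<xi> \<inter> bpath \<zeta> \<Longrightarrow> level x \<le> level (meet \<xi> \<zeta>)"
proof -
  obtain N where N: "\<xi> N \<noteq> \<zeta> N" using assms by blast
  have bound: "level x < N" if "x \<in> bpath \<xi> \<inter> bpath \<zeta>" for x
  proof (rule ccontr)
    assume "\<not> level x < N"
    then show False
      using that boundary_agree_mono[OF assms(1,2), of "level x" N] N
      unfolding bpath_Int_iff[OF assms(1,2)] by (metis linorder_not_less)
  qed
  have root: "[] \<in> bpath \<xi> \<inter> bpath \<zeta>"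
    using assms unfolding bpath_Int_iff[OF assms(1,2)] by (simp add: boundary_def)
  show "meet \<xi> \<zeta> \<in> bpath \<xi> \<inter> bpath \<zeta>"
    unfolding meet_def
    by (rule arg_max_natI[where P="\<lambda>x. x \<in> bpath \<xi> \<inter> bpath \<zeta>", OF root]) (use bound in blast)
  show "level x \<le> level (meet \<xi> \<zeta>)" if "x \<in> bpath \<xi> \<inter> bpath \<zeta>" for x
    unfolding meet_def
    by (rule arg_max_nat_le[where P="\<lambda>x. x \<in> bpath \<xi> \<inter> bpath \<zeta>", OF that]) (use bound in blast)
qed

lemma rho_le_iff:
  assumes "\<xi> \<in> boundary" "\<zeta> \<in> boundary"
  shows "rho \<xi> \<zeta> \<le> 2 powi (- int k) \<longleftrightarrow> \<xi> k = \<zeta> k"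
proof (cases "\<xi> = \<zeta>")
  case True
  then show ?thesis by (simp add: rho_def)
next
  case False
  let ?m = "meet \<xi> \<zeta>"
  have "rho \<xi> \<zeta> \<le> 2 powi (- int k) \<longleftrightarrow> k \<le> level ?m"
    using False by (simp add: rho_def power_int_minus field_simps)
  also have "\<dots> \<longleftrightarrow> \<xi> k = \<zeta> k"
  proof
    assume "k \<le> level ?m"
    moreover have "\<xi> (level ?m) = \<zeta> (level ?m)"
      using meet_props(1)[OF assms False] unfolding bpath_Int_iff[OF assms] by simp
    ultimately show "\<xi> k = \<zeta> k" using boundary_agree_mono assms by blast
  next
    assume "\<xi> k = \<zeta> k"
    then have "\<xi> k \<in> bpath \<xi> \<inter> bpath \<zeta>" unfolding bpath_def by (metis IntI rangeI)
    then have "level (\<xi> k) \<le> level ?m" using meet_props(2)[OF assms False] by blast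
    then show "k \<le> level ?m" using boundary_level[OF assms(1)] by simp
  qed
  finally show ?thesis .
qed

lemma Metric_space_rho: "Metric_space boundary rho"
proof
  show "0 \<le> rho \<xi> \<zeta>" for \<xi> \<zeta> by (simp add: rho_def)
  show "rho \<xi> \<zeta> = rho \<zeta> \<xi>" for \<xi> \<zeta> by (simp add: rho_def meet_def Int_commute)
  show "rho \<xi> \<zeta> = 0 \<longleftrightarrow> \<xi> = \<zeta>" for \<xi> \<zeta> by (simp add: rho_def)
  show "rho x z \<le> rho x y + rho y z"
    if B: "x \<in> boundary" "y \<in> boundary" "z \<in> boundary" for x y z
  proof (cases "x = y \<or> y = z")
    case True
    then show ?thesis by (auto simp: rho_def)
  next
    case False
    define a b where "a = level (meet x y)" and "b = level (meet y z)"
    have ra: "rho x y = 2 powi (- int a)" and rb: "rho y z = 2 powi (- int b)"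
      using False by (simp_all add: rho_def a_def b_def)
    have "x a = y a" "y b = z b" using rho_le_iff B ra rb by (metis order_refl)+
    then have "x (min a b) = z (min a b)"
      using B boundary_agree_mono by (metis min.cobounded1 min.cobounded2)
    then have "rho x z \<le> 2 powi (- int (min a b))" using rho_le_iff B by blast
    also have "\<dots> \<le> rho x y + rho y z" unfolding ra rb by (simp add: min_def)
    finally show ?thesis .
  qed
qed

definition bclosed :: "(nat \<Rightarrow> vertex) set \<Rightarrow> bool" where
  "bclosed E \<longleftrightarrow> closedin (Metric_space.mtopology boundary rho) E"

text \<open>Sums are taken in the extended reals, where a family of nonnegative terms always has a sum,
  possibly \<open>\<infinity>\<close>. \<open>path_sum \<phi> (vpath x)\<close> and \<open>path_sum \<phi> (bpath \<zeta>)\<close> are the values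
  \<open>I \<phi> x\<close> and \<open>I \<phi> \<zeta>\<close> at a vertex and at a boundary point.\<close>

definition path_sum :: "(vertex \<Rightarrow> real) \<Rightarrow> vertex set \<Rightarrow> ereal" where
  "path_sum \<phi> S = (\<Sum>\<^sub>\<infinity>x\<in>S. ereal (\<phi> x))"

definition norm_sq :: "(vertex \<Rightarrow> real) \<Rightarrow> ereal" where
  "norm_sq \<phi> = (\<Sum>\<^sub>\<infinity>x\<in>UNIV. ereal ((\<phi> x)\<^sup>2))"

definition cap :: "(nat \<Rightarrow> vertex) set \<Rightarrow> ereal" where
  "cap E = (INF \<phi> \<in> {\<phi>. (\<forall>x. 0 \<le> \<phi> x) \<and> (\<forall>\<zeta>\<in>E. 1 \<le> path_sum \<phi> (bpath \<zeta>))}. norm_sq \<phi>)"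

definition cap_level :: "nat \<Rightarrow> (nat \<Rightarrow> vertex) set \<Rightarrow> ereal" where
  "cap_level n E =
     (if n = 0 then cap E
      else INF \<phi> \<in> {\<phi>. (\<forall>x. 0 \<le> \<phi> x) \<and> (\<forall>\<zeta>\<in>E. 1 \<le> path_sum \<phi> (bpath \<zeta>)) \<and>
                       (\<forall>x. level x = n - 1 \<longrightarrow> path_sum \<phi> (vpath x) = 0)}. norm_sq \<phi>)"

primrec eseq :: "real \<Rightarrow> nat \<Rightarrow> real" where
  "eseq \<epsilon> 0 = \<epsilon>"
| "eseq \<epsilon> (Suc k) = eseq \<epsilon> k / (2 - 2 * eseq \<epsilon> k)"

end

theory Submission imports Defs begin

text \<open>If \<open>s\<close> is the sum of the capacities of the two branches of \<open>E\<close>, then \<open>cap E = s / (1 + s)\<close>,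
  while \<open>cap_level (Suc n) E\<close> is the sum of \<open>cap_level n\<close> over the branches. So \<open>cap E\<close> fixes only
  the sum of the branch capacities, and since \<open>c / (1 - (2 - 2 / 2 ^ n) * c)\<close> is convex in \<open>c\<close>,
  induction on \<open>n\<close> shows that equal branches are optimal. They can be realised because every value
  in \<open>[0, 1/2]\<close> is the capacity of a closed set: its branching is read off from the inverse of the
  recursion, and the recursion forgets its starting value.\<close>

section \<open>Splitting the tree at its first edge\<close>

definition bcons :: "bool \<Rightarrow> (nat \<Rightarrow> vertex) \<Rightarrow> nat \<Rightarrow> vertex" where
  "bcons b \<zeta> k = (case k of 0 \<Rightarrow> [] | Suc j \<Rightarrow> b # \<zeta> j)"

text \<open>The subtree below a child is identified with the whole tree, so a branch is again a set
  of geodesics from the root and every recursion on branches can be iterated.\<close>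

definition branch :: "bool \<Rightarrow> (nat \<Rightarrow> vertex) set \<Rightarrow> (nat \<Rightarrow> vertex) set" where
  "branch b E = {\<zeta> \<in> boundary. bcons b \<zeta> \<in> E}"

definition join :: "(bool \<Rightarrow> (nat \<Rightarrow> vertex) set) \<Rightarrow> (nat \<Rightarrow> vertex) set" where
  "join F = (\<Union>b. bcons b ` F b)"

text \<open>Assembles a weight from its root value and its restrictions to the two subtrees; by
  \<open>glue_eta\<close> every weight arises in this way.\<close>

definition glue :: "real \<Rightarrow> (bool \<Rightarrow> vertex \<Rightarrow> real) \<Rightarrow> vertex \<Rightarrow> real" where
  "glue t \<psi> x = (case x of [] \<Rightarrow> t | b # y \<Rightarrow> \<psi> b y)"

text \<open>One family of constraints serves both \<open>cap\<close> (at \<open>n = 0\<close>) and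
  \<open>cap_level n\<close>. The guard matters because natural subtraction is truncated: at
  \<open>n = 0\<close> the level condition would otherwise force the root weight to vanish.\<close>

definition adm :: "nat \<Rightarrow> (nat \<Rightarrow> vertex) set \<Rightarrow> (vertex \<Rightarrow> real) set" where
  "adm n E = {\<phi>. (\<forall>x. 0 \<le> \<phi> x) \<and> (\<forall>\<zeta>\<in>E. 1 \<le> path_sum \<phi> (bpath \<zeta>)) \<and>
    (n \<noteq> 0 \<longrightarrow> (\<forall>x. level x = n - 1 \<longrightarrow> path_sum \<phi> (vpath x) = 0))}"

lemma bcons_simps [simp]: "bcons b \<zeta> 0 = []" "bcons b \<zeta> (Suc k) = b # \<zeta> k"
  by (simp_all add: bcons_def)

lemma bcons_eq_iff [simp]: "bcons a \<xi> = bcons b \<zeta> \<longleftrightarrow> a = b \<and> \<xi> = \<zeta>"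
proof
  assume eq: "bcons a \<xi> = bcons b \<zeta>"
  have "a # \<xi> k = b # \<zeta> k" for k
    using fun_cong[OF eq, of "Suc k"] by simp
  then show "a = b \<and> \<xi> = \<zeta>" by auto
qed auto

lemma bcons_in_boundary [simp]: "bcons b \<zeta> \<in> boundary \<longleftrightarrow> \<zeta> \<in> boundary"
proof
  assume *: "bcons b \<zeta> \<in> boundary"
  have "\<exists>c. bcons b \<zeta> (Suc k) = bcons b \<zeta> k @ [c]" for k
    using * unfolding boundary_def by blast
  from this[of 0] this[of "Suc k" for k] show "\<zeta> \<in> boundary"
    by (auto simp: boundary_def)
next
  assume *: "\<zeta> \<in> boundary"
  have "\<exists>c. bcons b \<zeta> (Suc k) = bcons b \<zeta> k @ [c]" for k
    using * by (cases k) (auto simp: boundary_def)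
  then show "bcons b \<zeta> \<in> boundary" by (simp add: boundary_def)
qed

lemma boundary_bconsE:
  assumes "\<zeta> \<in> boundary"
  obtains b \<zeta>' where "\<zeta> = bcons b \<zeta>'" "\<zeta>' \<in> boundary"
proof -
  have z: "\<zeta> 0 = []" "\<exists>b. \<zeta> (Suc k) = \<zeta> k @ [b]" for k
    using assms by (auto simp: boundary_def)
  obtain b where b: "\<zeta> (Suc 0) = [b]" using z(2)[of 0] z(1) by auto
  \<comment> \<open>Each step appends at the end of the word, so the first letter, once chosen,
    never changes and can be stripped from all later vertices.\<close>
  have hd: "\<exists>y. \<zeta> (Suc k) = b # y" for k
  proof (induction k)
    case 0
    show ?case by (simp add: b)
  next
    case (Suc k)
    then show ?case using z(2)[of "Suc k"] by auto
  qed
  define \<zeta>' where "\<zeta>' = (\<lambda>k. tl (\<zeta> (Suc k)))"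
  have "\<zeta> k = bcons b \<zeta>' k" for k
  proof (cases k)
    case 0
    then show ?thesis by (simp add: z)
  next
    case (Suc j)
    then show ?thesis using hd[of j] by (auto simp: \<zeta>'_def)
  qed
  then have eq: "\<zeta> = bcons b \<zeta>'" by blast
  then have "\<zeta>' \<in> boundary" using assms by simp
  with eq that show ?thesis by blast
qed

lemma branch_subset: "branch b E \<subseteq> boundary"
  by (auto simp: branch_def)

lemma branch_boundary [simp]: "branch b boundary = boundary"
  by (auto simp: branch_def)

lemma branch_join [simp]: "F b \<subseteq> boundary \<Longrightarrow> branch b (join F) = F b"
  by (auto simp: branch_def join_def)

lemma join_subset:
  assumes "\<And>b. F b \<subseteq> boundary"
  shows "join F \<subseteq> boundary"
proof
  fix \<xi> assume "\<xi> \<in> join F"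
  then obtain b \<zeta> where "\<xi> = bcons b \<zeta>" "\<zeta> \<in> F b" by (auto simp: join_def)
  then show "\<xi> \<in> boundary" using assms[of b] by auto
qed

section \<open>Closed sets in combinatorial form\<close>

text \<open>By \<open>rho_le_iff\<close>, the geodesics within distance
  \<open>2 powi (- int k)\<close> of \<open>\<xi>\<close> are those agreeing with it up to level
  \<open>k\<close>. Hence \<open>\<xi>\<close> is a limit of \<open>E\<close> iff each of its
  initial segments is shared by a member of \<open>E\<close>.\<close>

lemma bclosed_iff:
  "bclosed E \<longleftrightarrow> E \<subseteq> boundary \<and>
    (\<forall>\<xi>\<in>boundary. (\<forall>k. \<exists>\<zeta>\<in>E. \<zeta> k = \<xi> k) \<longrightarrow> \<xi> \<in> E)"
proof -
  interpret M: Metric_space boundary rho by (rule Metric_space_rho)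
  have "(\<exists>r>0. disjnt E (M.mball \<xi> r)) \<longleftrightarrow> \<not> (\<forall>k. \<exists>\<zeta>\<in>E. \<zeta> k = \<xi> k)"
    if sub: "E \<subseteq> boundary" and \<xi>: "\<xi> \<in> boundary" for \<xi>
  proof
    assume "\<exists>r>0. disjnt E (M.mball \<xi> r)"
    then obtain r where r: "r > 0" "disjnt E (M.mball \<xi> r)" by blast
    obtain k where k: "(1/2::real) ^ k < r"
      using real_arch_pow_inv[OF r(1), of "1/2"] by auto
    have k': "2 powi (- int k) < r"
      using k by (simp add: power_int_minus power_one_over field_simps)
    have "\<zeta> k \<noteq> \<xi> k" if "\<zeta> \<in> E" for \<zeta>
    proof
      assume "\<zeta> k = \<xi> k"
      then have "rho \<xi> \<zeta> \<le> 2 powi (- int k)"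
        using rho_le_iff[of \<xi> \<zeta> k] \<xi> sub that by auto
      then have "\<zeta> \<in> M.mball \<xi> r" using k' \<xi> sub that by (auto simp: M.in_mball)
      then show False using r(2) that by (auto simp: disjnt_def)
    qed
    then show "\<not> (\<forall>k. \<exists>\<zeta>\<in>E. \<zeta> k = \<xi> k)" by blast
  next
    assume "\<not> (\<forall>k. \<exists>\<zeta>\<in>E. \<zeta> k = \<xi> k)"
    then obtain k where k: "\<And>\<zeta>. \<zeta> \<in> E \<Longrightarrow> \<zeta> k \<noteq> \<xi> k" by blast
    have "disjnt E (M.mball \<xi> (2 powi (- int k)))"
      unfolding disjnt_iff
    proof (intro allI notI)
      fix \<zeta> assume *: "\<zeta> \<in> E \<and> \<zeta> \<in> M.mball \<xi> (2 powi (- int k))"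
      then have "\<xi> k = \<zeta> k"
        using rho_le_iff[of \<xi> \<zeta> k] by (simp add: M.in_mball)
      then show False using k * by metis
    qed
    then show "\<exists>r>0. disjnt E (M.mball \<xi> r)"
      by (intro exI[of _ "2 powi (- int k)"]) simp
  qed
  then show ?thesis
    unfolding bclosed_def M.closedin_metric by blast
qed

lemma bclosed_subset: "bclosed E \<Longrightarrow> E \<subseteq> boundary"
  by (simp add: bclosed_iff)

text \<open>Agreement at level \<open>Suc k\<close> includes the first letter, so approximants of a
  geodesic through \<open>[b]\<close> all come from \<open>F b\<close>, and agreement drops by one
  level there.\<close>

lemma bclosed_join:
  assumes "\<And>b. bclosed (F b)"
  shows "bclosed (join F)"
  unfolding bclosed_iff
proof (intro conjI ballI impI)
  show "join F \<subseteq> boundary"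
    using assms by (intro join_subset bclosed_subset)
  fix \<xi> assume \<xi>: "\<xi> \<in> boundary" and lim: "\<forall>k. \<exists>\<zeta>\<in>join F. \<zeta> k = \<xi> k"
  obtain b \<xi>' where b: "\<xi> = bcons b \<xi>'" "\<xi>' \<in> boundary" using \<xi> by (rule boundary_bconsE)
  have "\<exists>\<zeta>\<in>F b. \<zeta> k = \<xi>' k" for k
    using spec[OF lim, of "Suc k"] by (auto simp: join_def b)
  then have "\<xi>' \<in> F b" using assms[of b] b(2) by (simp add: bclosed_iff)
  then show "\<xi> \<in> join F" by (auto simp: join_def b)
qed

section \<open>Sums of nonnegative families\<close>

text \<open>Addition on \<open>ereal\<close> is discontinuous at opposite infinities, while on
  \<open>ennreal\<close> it is continuous. Nonnegative sums are therefore split over disjoint sets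
  in \<open>ennreal\<close> and carried back.\<close>

lemma infsum_ereal_eq_ennreal:
  fixes f :: "'a \<Rightarrow> real"
  assumes "\<And>x. x \<in> A \<Longrightarrow> 0 \<le> f x"
  shows "(\<Sum>\<^sub>\<infinity>x\<in>A. ereal (f x)) = enn2ereal (\<Sum>\<^sub>\<infinity>x\<in>A. ennreal (f x))"
proof -
  have "infsum (enn2ereal \<circ> (\<lambda>x. ennreal (f x))) A = enn2ereal (\<Sum>\<^sub>\<infinity>x\<in>A. ennreal (f x))"
    by (rule infsum_comm_additive_general)
      (auto simp: continuous_at_enn2ereal sum_enn2ereal intro: nonneg_summable_on_complete)
  moreover have "infsum (enn2ereal \<circ> (\<lambda>x. ennreal (f x))) A = (\<Sum>\<^sub>\<infinity>x\<in>A. ereal (f x))"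
    by (rule infsum_cong) (simp add: assms)
  ultimately show ?thesis by simp
qed

lemma infsum_ereal_Un_disjoint:
  fixes f :: "'a \<Rightarrow> real"
  assumes "\<And>x. x \<in> A \<union> B \<Longrightarrow> 0 \<le> f x" "A \<inter> B = {}"
  shows "(\<Sum>\<^sub>\<infinity>x\<in>A \<union> B. ereal (f x)) = (\<Sum>\<^sub>\<infinity>x\<in>A. ereal (f x)) + (\<Sum>\<^sub>\<infinity>x\<in>B. ereal (f x))"
proof -
  have "(\<Sum>\<^sub>\<infinity>x\<in>A \<union> B. ennreal (f x)) = (\<Sum>\<^sub>\<infinity>x\<in>A. ennreal (f x)) + (\<Sum>\<^sub>\<infinity>x\<in>B. ennreal (f x))"
    using assms(2) by (intro infsum_Un_disjoint) (auto intro: nonneg_summable_on_complete)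
  moreover have "\<And>x. x \<in> A \<Longrightarrow> 0 \<le> f x" "\<And>x. x \<in> B \<Longrightarrow> 0 \<le> f x" using assms(1) by auto
  ultimately show ?thesis
    using assms(1) by (simp only: infsum_ereal_eq_ennreal plus_ennreal.rep_eq)
qed

lemma infsum_ereal_cmult:
  fixes f :: "'a \<Rightarrow> real"
  assumes "0 \<le> c" "\<And>x. x \<in> A \<Longrightarrow> 0 \<le> f x"
  shows "(\<Sum>\<^sub>\<infinity>x\<in>A. ereal (c * f x)) = ereal c * (\<Sum>\<^sub>\<infinity>x\<in>A. ereal (f x))"
proof -
  have "infsum ((\<lambda>u. ereal c * u) \<circ> (\<lambda>x. ereal (f x))) A = ereal c * (\<Sum>\<^sub>\<infinity>x\<in>A. ereal (f x))"
  proof (rule infsum_comm_additive_general)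
    show "sum ((\<lambda>u. ereal c * u) \<circ> (\<lambda>x. ereal (f x))) F = ereal c * (\<Sum>x\<in>F. ereal (f x))" for F
      by (simp add: sum_distrib_left)
    show "isCont (\<lambda>u. ereal c * u) (\<Sum>\<^sub>\<infinity>x\<in>A. ereal (f x))"
      unfolding isCont_def by (rule tendsto_cmult_ereal) auto
    show "(\<lambda>x. ereal (f x)) summable_on A"
      by (rule nonneg_summable_on_complete) (simp add: assms)
  qed
  then show ?thesis by (simp add: o_def)
qed

section \<open>Norms and path sums under scaling and splitting\<close>

lemma norm_sq_nonneg [simp]: "0 \<le> norm_sq \<phi>"
  unfolding norm_sq_def by (rule infsum_nonneg) simp

lemma path_sum_nonneg: "(\<And>x. 0 \<le> \<phi> x) \<Longrightarrow> 0 \<le> path_sum \<phi> S"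
  unfolding path_sum_def by (rule infsum_nonneg) simp

lemma norm_sq_cmult: "norm_sq (\<lambda>x. c * \<phi> x) = ereal (c\<^sup>2) * norm_sq \<phi>"
  unfolding norm_sq_def power_mult_distrib by (rule infsum_ereal_cmult) auto

lemma path_sum_cmult:
  assumes "0 \<le> c" "\<And>x. 0 \<le> \<phi> x"
  shows "path_sum (\<lambda>x. c * \<phi> x) S = ereal c * path_sum \<phi> S"
  unfolding path_sum_def by (rule infsum_ereal_cmult) (use assms in auto)

lemma glue_simps [simp]: "glue t \<psi> [] = t" "glue t \<psi> (b # y) = \<psi> b y"
  by (simp_all add: glue_def)

lemma glue_eta: "glue (\<phi> []) (\<lambda>b y. \<phi> (b # y)) = \<phi>"
  by (rule ext) (simp add: glue_def split: list.splits)

lemma norm_sq_glue: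
  "norm_sq (glue t \<psi>) = ereal (t\<^sup>2) + (norm_sq (\<psi> True) + norm_sq (\<psi> False))"
proof -
  let ?f = "\<lambda>x. (glue t \<psi> x)\<^sup>2"
  have U: "(UNIV :: vertex set) = {[]} \<union> (Cons True ` UNIV \<union> Cons False ` UNIV)"
  proof -
    have "x \<in> {[]} \<union> (Cons True ` UNIV \<union> Cons False ` UNIV)" for x :: vertex
      by (cases x) auto
    then show ?thesis by blast
  qed
  have N: "(\<Sum>\<^sub>\<infinity>x\<in>Cons b ` UNIV. ereal (?f x)) = norm_sq (\<psi> b)" for b
    by (subst infsum_reindex) (auto simp: o_def norm_sq_def)
  show ?thesis
    unfolding norm_sq_def[of "glue t \<psi>"]
    by (subst U, subst infsum_ereal_Un_disjoint, simp, blast,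
        subst infsum_ereal_Un_disjoint, simp, blast) (simp add: N)
qed

text \<open>Paths to vertices below a child and paths to boundary points both have this shape, so
  one computation serves \<open>vpath\<close> and \<open>bpath\<close>.\<close>

lemma path_sum_insert_Cons:
  assumes "\<And>x. 0 \<le> \<phi> x"
  shows "path_sum \<phi> (insert [] (Cons b ` S)) = ereal (\<phi> []) + path_sum (\<lambda>y. \<phi> (b # y)) S"
proof -
  have "path_sum \<phi> ({[]} \<union> Cons b ` S) = path_sum \<phi> {[]} + path_sum \<phi> (Cons b ` S)"
    unfolding path_sum_def using assms by (intro infsum_ereal_Un_disjoint) auto
  moreover have "path_sum \<phi> (Cons b ` S) = path_sum (\<lambda>y. \<phi> (b # y)) S"
    unfolding path_sum_def by (subst infsum_reindex) (auto simp: o_def)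
  ultimately show ?thesis by (simp add: path_sum_def)
qed

lemma bpath_bcons: "bpath (bcons b \<zeta>) = insert [] (Cons b ` bpath \<zeta>)"
proof -
  have "range (bcons b \<zeta>) = insert (bcons b \<zeta> 0) (range (\<lambda>k. bcons b \<zeta> (Suc k)))"
    by (subst UNIV_nat_eq) (simp add: image_image)
  then show ?thesis by (auto simp: bpath_def)
qed

lemma vpath_Nil: "vpath [] = {[]}"
  by (auto simp: vpath_def)

lemma vpath_Cons: "vpath (b # x) = insert [] (Cons b ` vpath x)"
  by (auto simp: vpath_def image_iff prefix_Cons)

section \<open>The recursion for the level capacities\<close>

lemma cap_level_eq_INF: "cap_level n E = (INF \<phi>\<in>adm n E. norm_sq \<phi>)"
  by (simp add: cap_level_def cap_def adm_def)

lemma cap_eq_INF: "cap E = (INF \<phi>\<in>adm 0 E. norm_sq \<phi>)"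
  by (simp add: cap_def adm_def)

lemma cap_nonneg: "0 \<le> cap E"
  unfolding cap_eq_INF by (rule INF_greatest) simp

lemma path_sum_bcons:
  assumes "\<And>x. 0 \<le> \<phi> x"
  shows "path_sum \<phi> (bpath (bcons b \<zeta>)) = ereal (\<phi> []) + path_sum (\<lambda>y. \<phi> (b # y)) (bpath \<zeta>)"
  unfolding bpath_bcons by (rule path_sum_insert_Cons) (fact assms)

lemma path_sum_vpath_Cons:
  assumes "\<And>x. 0 \<le> \<phi> x"
  shows "path_sum \<phi> (vpath (b # x)) = ereal (\<phi> []) + path_sum (\<lambda>y. \<phi> (b # y)) (vpath x)"
  unfolding vpath_Cons by (rule path_sum_insert_Cons) (fact assms)

lemma glue_nonneg: "0 \<le> t \<Longrightarrow> (\<And>b y. 0 \<le> \<psi> b y) \<Longrightarrow> 0 \<le> glue t \<psi> x"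
  by (cases x) auto

text \<open>A root of weight 0 adds nothing to any path sum, and passing from a branch to the whole
  tree lowers the vanishing level by one edge.\<close>

lemma glue_in_adm_Suc:
  assumes "\<And>b. \<psi> b \<in> adm n (branch b E)" "E \<subseteq> boundary"
  shows "glue 0 \<psi> \<in> adm (Suc n) E"
proof -
  have \<psi>: "0 \<le> \<psi> b y" for b y using assms(1)[of b] by (simp add: adm_def)
  have nn: "0 \<le> glue 0 \<psi> x" for x by (simp add: glue_nonneg \<psi>)
  have "1 \<le> path_sum (glue 0 \<psi>) (bpath \<zeta>)" if "\<zeta> \<in> E" for \<zeta>
  proof -
    have "\<zeta> \<in> boundary" using that assms(2) by blast
    then obtain b \<zeta>' where b: "\<zeta> = bcons b \<zeta>'" "\<zeta>' \<in> boundary" by (rule boundary_bconsE)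
    then have "\<zeta>' \<in> branch b E" using that by (simp add: branch_def)
    then have "1 \<le> path_sum (\<psi> b) (bpath \<zeta>')" using assms(1)[of b] by (simp add: adm_def)
    then show ?thesis using nn by (simp add: b path_sum_bcons)
  qed
  moreover have "path_sum (glue 0 \<psi>) (vpath x) = 0" if "level x = n" for x
  proof (cases x)
    case Nil
    then show ?thesis by (simp add: vpath_Nil path_sum_def)
  next
    case (Cons b y)
    then have "path_sum (\<psi> b) (vpath y) = 0"
      using assms(1)[of b] that by (auto simp: adm_def)
    then show ?thesis using nn by (simp add: Cons path_sum_vpath_Cons)
  qed
  ultimately show ?thesis using nn by (simp add: adm_def)
qed

text \<open>Path sums have nonnegative terms, so a vanishing sum kills the root weight and the
  remaining part separately. Together with \<open>glue_in_adm_Suc\<close> this identifies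
  \<open>adm (Suc n) E\<close> with pairs of weights admissible for the branches.\<close>

lemma adm_SucD:
  assumes "\<phi> \<in> adm (Suc n) E"
  shows "\<phi> [] = 0" "(\<lambda>y. \<phi> (b # y)) \<in> adm n (branch b E)"
proof -
  have nn: "0 \<le> \<phi> x" for x using assms by (simp add: adm_def)
  have z: "path_sum \<phi> (vpath x) = 0" if "level x = n" for x
    using assms that by (simp add: adm_def)
  have both: "\<phi> [] = 0 \<and> path_sum (\<lambda>y. \<phi> (c # y)) (vpath y) = 0" if "Suc (level y) = n" for c y
  proof -
    have "ereal (\<phi> []) + path_sum (\<lambda>y. \<phi> (c # y)) (vpath y) = 0"
      using z[of "c # y"] that nn by (simp add: path_sum_vpath_Cons)
    then show ?thesis
      using nn[of "[]"] path_sum_nonneg[of "\<lambda>y. \<phi> (c # y)" "vpath y"] nn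
      by (cases "path_sum (\<lambda>y. \<phi> (c # y)) (vpath y)")
        (auto simp: zero_ereal_def add_nonneg_eq_0_iff)
  qed
  \<comment> \<open>At \<open>n = 0\<close> the constraint sits at the root itself. Otherwise any
    vertex of level \<open>n\<close> has the root on its path, and
    \<open>True # replicate m True\<close> is one.\<close>
  show z0: "\<phi> [] = 0"
  proof (cases n)
    case 0
    then show ?thesis using z[of "[]"] by (simp add: vpath_Nil path_sum_def zero_ereal_def)
  next
    case (Suc m)
    then show ?thesis using both[of "replicate m True"] by simp
  qed
  show "(\<lambda>y. \<phi> (b # y)) \<in> adm n (branch b E)"
    unfolding adm_def
  proof (clarsimp simp: nn, intro conjI ballI impI allI)
    fix \<zeta> assume "\<zeta> \<in> branch b E"
    then have "1 \<le> path_sum \<phi> (bpath (bcons b \<zeta>))" using assms by (simp add: adm_def branch_def)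
    then show "1 \<le> path_sum (\<lambda>y. \<phi> (b # y)) (bpath \<zeta>)" using nn by (simp add: path_sum_bcons z0)
  next
    fix x :: vertex assume "0 < n" "level x = n - Suc 0"
    then show "path_sum (\<lambda>y. \<phi> (b # y)) (vpath x) = 0" using both[of x b] by simp
  qed
qed

text \<open>Weights on the two branches are chosen independently, so a bound valid for all pairs
  passes to the sum of the infima. Nonnegativity rules out opposite infinities; an empty index set
  makes the right side infinite.\<close>

lemma INF_ereal_add_independent:
  fixes f :: "'a \<Rightarrow> ereal" and g :: "'b \<Rightarrow> ereal"
  assumes "\<And>x. 0 \<le> f x" "\<And>y. 0 \<le> g y"
    and "\<And>x y. x \<in> A \<Longrightarrow> y \<in> B \<Longrightarrow> u \<le> f x + g y"
  shows "u \<le> (INF x\<in>A. f x) + (INF y\<in>B. g y)"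
proof (cases "A = {} \<or> B = {}")
  case True
  have "0 \<le> (INF x\<in>A. f x)" "0 \<le> (INF y\<in>B. g y)" by (auto intro!: INF_greatest assms)
  then show ?thesis using True by (auto simp: top_ereal_def)
next
  case False
  have B: "0 \<le> (INF y\<in>B. g y)" by (auto intro!: INF_greatest assms)
  have 1: "f x + (INF y\<in>B. g y) = (INF y\<in>B. f x + g y)" for x
    using INF_ereal_add_right[of B "f x" g] False assms(1)[of x] assms(2) by auto
  have "(INF x\<in>A. f x) + (INF y\<in>B. g y) = (INF x\<in>A. f x + (INF y\<in>B. g y))"
    using INF_ereal_add_left[of A "INF y\<in>B. g y" f] False assms(1) B by auto
  then show ?thesis unfolding 1 using assms(3) by (auto intro!: INF_greatest)
qed

lemma cap_level_Suc:
  assumes "E \<subseteq> boundary"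
  shows "cap_level (Suc n) E = cap_level n (branch True E) + cap_level n (branch False E)"
proof (rule antisym)
  show "cap_level (Suc n) E \<le> cap_level n (branch True E) + cap_level n (branch False E)"
    unfolding cap_level_eq_INF
  proof (rule INF_ereal_add_independent)
    fix \<phi> \<psi> assume "\<phi> \<in> adm n (branch True E)" "\<psi> \<in> adm n (branch False E)"
    then have "glue 0 (\<lambda>b. if b then \<phi> else \<psi>) \<in> adm (Suc n) E"
      using assms by (intro glue_in_adm_Suc) auto
    then have "(INF \<phi>\<in>adm (Suc n) E. norm_sq \<phi>) \<le> norm_sq (glue 0 (\<lambda>b. if b then \<phi> else \<psi>))"
      by (rule INF_lower)
    then show "(INF \<phi>\<in>adm (Suc n) E. norm_sq \<phi>) \<le> norm_sq \<phi> + norm_sq \<psi>"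
      by (simp add: norm_sq_glue)
  qed auto
  show "cap_level n (branch True E) + cap_level n (branch False E) \<le> cap_level (Suc n) E"
    unfolding cap_level_eq_INF[of "Suc n"]
  proof (rule INF_greatest)
    fix \<phi> assume \<phi>: "\<phi> \<in> adm (Suc n) E"
    have "norm_sq \<phi> = norm_sq (\<lambda>y. \<phi> (True # y)) + norm_sq (\<lambda>y. \<phi> (False # y))"
      using norm_sq_glue[of "\<phi> []" "\<lambda>b y. \<phi> (b # y)"] adm_SucD(1)[OF \<phi>]
      unfolding glue_eta by simp
    then show "cap_level n (branch True E) + cap_level n (branch False E) \<le> norm_sq \<phi>"
      using adm_SucD(2)[OF \<phi>] unfolding cap_level_eq_INF
      by (auto intro!: add_mono INF_lower)
  qed
qed

section \<open>The recursion for the capacity\<close>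

lemma path_sum_one_le:
  assumes "\<And>x. 0 \<le> \<phi> x" "x \<in> S"
  shows "ereal (\<phi> x) \<le> path_sum \<phi> S"
proof -
  have "path_sum \<phi> ({x} \<union> (S - {x})) = path_sum \<phi> {x} + path_sum \<phi> (S - {x})"
    unfolding path_sum_def using assms by (intro infsum_ereal_Un_disjoint) auto
  moreover have "{x} \<union> (S - {x}) = S" using assms(2) by auto
  moreover have "path_sum \<phi> {x} = ereal (\<phi> x)" by (simp add: path_sum_def)
  ultimately show ?thesis
    using path_sum_nonneg[of \<phi> "S - {x}"] assms(1) by (simp add: ereal_le_add_self)
qed

lemma norm_sq_zero [simp]: "norm_sq (\<lambda>x. 0) = 0"
  unfolding norm_sq_def by (simp add: zero_ereal_def[symmetric])

lemma Nil_in_bpath: "\<zeta> \<in> boundary \<Longrightarrow> [] \<in> bpath \<zeta>"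
  unfolding bpath_def boundary_def by (metis (mono_tags, lifting) mem_Collect_eq rangeI)

lemma cap_le_1:
  assumes "E \<subseteq> boundary"
  shows "cap E \<le> 1"
proof -
  let ?\<phi> = "glue 1 (\<lambda>b y. 0)"
  have nn: "0 \<le> ?\<phi> x" for x by (simp add: glue_nonneg)
  have "?\<phi> \<in> adm 0 E"
    using assms Nil_in_bpath nn path_sum_one_le[of ?\<phi> "[]"] by (auto simp: adm_def one_ereal_def)
  then have "cap E \<le> norm_sq ?\<phi>" unfolding cap_eq_INF by (rule INF_lower)
  then show ?thesis by (simp add: norm_sq_glue one_ereal_def)
qed

lemma cap_finite:
  assumes "E \<subseteq> boundary"
  obtains c where "cap E = ereal c" "0 \<le> c" "c \<le> 1"
  using cap_le_1[OF assms] cap_nonneg[of E] by (cases "cap E") (auto simp: one_ereal_def)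

lemma cap_mono: "E \<subseteq> F \<Longrightarrow> cap E \<le> cap F"
  unfolding cap_eq_INF by (rule INF_superset_mono) (auto simp: adm_def)

lemma cap_empty [simp]: "cap {} = 0"
proof -
  have "cap {} \<le> norm_sq (\<lambda>x. 0)"
    unfolding cap_eq_INF by (rule INF_lower) (simp add: adm_def)
  then show ?thesis using cap_nonneg[of "{}"] by simp
qed

lemma glue_in_adm_0:
  assumes "\<And>b. \<psi> b \<in> adm 0 (branch b E)" "E \<subseteq> boundary" "0 \<le> t" "t \<le> 1"
  shows "glue t (\<lambda>b y. (1 - t) * \<psi> b y) \<in> adm 0 E"
proof -
  have \<psi>: "0 \<le> \<psi> b y" for b y using assms(1)[of b] by (simp add: adm_def)
  let ?\<phi> = "glue t (\<lambda>b y. (1 - t) * \<psi> b y)"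
  have nn: "0 \<le> ?\<phi> x" for x using assms by (simp add: glue_nonneg \<psi>)
  have "1 \<le> path_sum ?\<phi> (bpath \<zeta>)" if "\<zeta> \<in> E" for \<zeta>
  proof -
    have "\<zeta> \<in> boundary" using that assms(2) by blast
    then obtain b \<zeta>' where b: "\<zeta> = bcons b \<zeta>'" "\<zeta>' \<in> boundary" by (rule boundary_bconsE)
    then have "\<zeta>' \<in> branch b E" using that by (simp add: branch_def)
    then have 1: "1 \<le> path_sum (\<psi> b) (bpath \<zeta>')" using assms(1)[of b] by (simp add: adm_def)
    have "1 = ereal t + ereal (1 - t) * 1" by (simp add: one_ereal_def)
    also have "\<dots> \<le> ereal t + ereal (1 - t) * path_sum (\<psi> b) (bpath \<zeta>')"
      by (intro add_left_mono ereal_mult_left_mono 1) (use assms in simp)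
    also have "\<dots> = path_sum ?\<phi> (bpath \<zeta>)"
      using assms nn by (simp add: b path_sum_bcons path_sum_cmult \<psi>)
    finally show ?thesis .
  qed
  then show ?thesis using nn by (simp add: adm_def)
qed

text \<open>A branch still has to supply \<open>1 - \<phi> []\<close> along each geodesic, so
  dividing by this amount restores the bound 1. Positivity of the divisor is why the root weight
  must lie below 1.\<close>

lemma adm_0_branch:
  assumes "\<phi> \<in> adm 0 E" "\<phi> [] < 1"
  shows "(\<lambda>y. inverse (1 - \<phi> []) * \<phi> (b # y)) \<in> adm 0 (branch b E)"
proof -
  have nn: "0 \<le> \<phi> x" for x using assms by (simp add: adm_def)
  let ?t = "\<phi> []"
  have "1 \<le> ereal (inverse (1 - ?t)) * path_sum (\<lambda>y. \<phi> (b # y)) (bpath \<zeta>)"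
    if "\<zeta> \<in> branch b E" for \<zeta>
  proof -
    have "1 \<le> path_sum \<phi> (bpath (bcons b \<zeta>))" using assms that by (simp add: adm_def branch_def)
    then have "1 \<le> ereal ?t + path_sum (\<lambda>y. \<phi> (b # y)) (bpath \<zeta>)"
      using nn by (simp add: path_sum_bcons)
    then show ?thesis using assms(2)
      by (cases "path_sum (\<lambda>y. \<phi> (b # y)) (bpath \<zeta>)") (auto simp: one_ereal_def field_simps)
  qed
  then show ?thesis using nn assms(2) by (simp add: adm_def path_sum_cmult)
qed

text \<open>Completing the square: after multiplication by \<open>1 + s\<close> the difference is a
  square, vanishing exactly at \<open>t = s / (1 + s)\<close>.\<close>

lemma quadratic_ge:
  fixes s t :: real
  assumes "0 \<le> s"
  shows "s / (1 + s) \<le> t\<^sup>2 + (1 - t)\<^sup>2 * s"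
proof -
  have "(t\<^sup>2 + (1 - t)\<^sup>2 * s) * (1 + s) - s = (t + t * s - s)\<^sup>2"
    by (simp add: power2_eq_square algebra_simps)
  then have "s \<le> (t\<^sup>2 + (1 - t)\<^sup>2 * s) * (1 + s)" by (smt (verit) zero_le_power2)
  then show ?thesis using assms by (simp add: pos_divide_le_eq)
qed

text \<open>Giving the root the weight \<open>t\<close> leaves each branch the task of reaching \<open>1 - t\<close>, at cost
  \<open>(1 - t)\<^sup>2\<close> times its capacity; \<open>t\<^sup>2 + (1 - t)\<^sup>2 * s\<close> is minimal at \<open>t = s / (1 + s)\<close>.\<close>

lemma cap_branches:
  assumes E: "E \<subseteq> boundary"
    and a: "cap (branch True E) = ereal a" and b: "cap (branch False E) = ereal b"
  shows "cap E = ereal ((a + b) / (1 + (a + b)))"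
proof -
  obtain e where e: "cap E = ereal e" using cap_finite[OF E] by blast
  have nn: "0 \<le> a" "0 \<le> b"
    using cap_nonneg[of "branch True E"] cap_nonneg[of "branch False E"] a b by auto
  define s where "s = a + b"
  have s: "0 \<le> s" using nn by (simp add: s_def)
  define t where "t = s / (1 + s)"
  have t: "0 \<le> t" "t \<le> 1" "1 - t = 1 / (1 + s)" using s by (auto simp: t_def field_simps)
  have "e \<le> s / (1 + s) + \<delta>" if "\<delta> > 0" for \<delta>
  proof -
    \<comment> \<open>Near-optimal weights stand in for minimisers. Each exceeds the capacity of its
      branch by less than \<open>\<delta> / 2\<close>, and the factor
      \<open>(1 - t)\<^sup>2 \<le> 1\<close> keeps the total excess within
      \<open>\<delta>\<close>.\<close>
    have ex: "\<exists>\<phi>\<in>adm 0 F. norm_sq \<phi> < ereal (c + \<delta> / 2)" if "cap F = ereal c" for F c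
    proof -
      have "cap F < ereal (c + \<delta> / 2)" using that \<open>\<delta> > 0\<close> by simp
      then show ?thesis unfolding cap_eq_INF INF_less_iff .
    qed
    obtain \<phi> where \<phi>: "\<phi> \<in> adm 0 (branch True E)" "norm_sq \<phi> < ereal (a + \<delta> / 2)" using ex[OF a] by blast
    obtain \<psi> where \<psi>: "\<psi> \<in> adm 0 (branch False E)" "norm_sq \<psi> < ereal (b + \<delta> / 2)" using ex[OF b] by blast
    obtain p where p: "norm_sq \<phi> = ereal p" "p < a + \<delta> / 2"
      using \<phi>(2) norm_sq_nonneg[of \<phi>] by (cases "norm_sq \<phi>") auto
    obtain q where q: "norm_sq \<psi> = ereal q" "q < b + \<delta> / 2"
      using \<psi>(2) norm_sq_nonneg[of \<psi>] by (cases "norm_sq \<psi>") auto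
    let ?g = "glue t (\<lambda>c y. (1 - t) * (if c then \<phi> else \<psi>) y)"
    have "?g \<in> adm 0 E" using \<phi> \<psi> E t by (intro glue_in_adm_0) auto
    then have "cap E \<le> norm_sq ?g" unfolding cap_eq_INF by (rule INF_lower)
    then have "e \<le> t\<^sup>2 + ((1 - t)\<^sup>2 * p + (1 - t)\<^sup>2 * q)"
      by (simp add: norm_sq_glue norm_sq_cmult p q e)
    also have "\<dots> = t\<^sup>2 + (1 - t)\<^sup>2 * (p + q)" by (simp add: algebra_simps)
    also have "\<dots> \<le> t\<^sup>2 + (1 - t)\<^sup>2 * (s + \<delta>)"
      using p q by (intro add_left_mono mult_left_mono) (auto simp: s_def)
    also have "\<dots> = t\<^sup>2 + (1 - t)\<^sup>2 * s + (1 - t)\<^sup>2 * \<delta>" by (simp add: algebra_simps)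
    also have "\<dots> \<le> t\<^sup>2 + (1 - t)\<^sup>2 * s + 1 * \<delta>"
      using that t(1,2) by (intro add_left_mono mult_right_mono power_le_one) auto
    also have "t\<^sup>2 + (1 - t)\<^sup>2 * s = s / (1 + s)"
    proof -
      have "t\<^sup>2 + (1 - t)\<^sup>2 * s = (s * (1 + s)) / (1 + s)\<^sup>2"
        unfolding t(3) unfolding t_def
        by (simp add: power_divide power2_eq_square add_divide_distrib[symmetric] algebra_simps)
      then show ?thesis using s by (simp add: power2_eq_square)
    qed
    finally show ?thesis by simp
  qed
  then have upper: "e \<le> s / (1 + s)" by (rule field_le_epsilon)
  have "ereal (s / (1 + s)) \<le> cap E"
    unfolding cap_eq_INF
  proof (rule INF_greatest)
    fix \<phi> assume \<phi>: "\<phi> \<in> adm 0 E"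
    have dec: "norm_sq \<phi> = ereal ((\<phi> [])\<^sup>2) + (norm_sq (\<lambda>y. \<phi> (True # y)) + norm_sq (\<lambda>y. \<phi> (False # y)))"
      using norm_sq_glue[of "\<phi> []" "\<lambda>b y. \<phi> (b # y)"] unfolding glue_eta by simp
    \<comment> \<open>A root weight of at least 1 already costs more than the bound; otherwise the
      branches can be rescaled.\<close>
    show "ereal (s / (1 + s)) \<le> norm_sq \<phi>"
    proof (cases "1 \<le> \<phi> []")
      case True
      have "s / (1 + s) \<le> 1" using s by simp
      also have "1 \<le> (\<phi> [])\<^sup>2" using True by (simp add: one_le_power)
      finally have "ereal (s / (1 + s)) \<le> ereal ((\<phi> [])\<^sup>2)" by simp
      also have "\<dots> \<le> norm_sq \<phi>" unfolding dec by (simp add: ereal_le_add_self)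
      finally show ?thesis .
    next
      case False
      let ?u = "1 - \<phi> []"
      have u: "?u > 0" using False by simp
      have br: "ereal (?u\<^sup>2 * x) \<le> norm_sq (\<lambda>y. \<phi> (c # y))" if x: "cap (branch c E) = ereal x" for c x
      proof -
        have "cap (branch c E) \<le> norm_sq (\<lambda>y. inverse ?u * \<phi> (c # y))"
          unfolding cap_eq_INF by (rule INF_lower) (use adm_0_branch[OF \<phi>] False in simp)
        then have "ereal x \<le> ereal ((inverse ?u)\<^sup>2) * norm_sq (\<lambda>y. \<phi> (c # y))"
          unfolding x norm_sq_cmult .
        then show ?thesis using u norm_sq_nonneg[of "\<lambda>y. \<phi> (c # y)"]
          by (cases "norm_sq (\<lambda>y. \<phi> (c # y))") (auto simp: power_inverse field_simps)
      qed
      have "s / (1 + s) \<le> (\<phi> [])\<^sup>2 + ?u\<^sup>2 * s" using s by (rule quadratic_ge)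
      then have "ereal (s / (1 + s)) \<le> ereal ((\<phi> [])\<^sup>2) + (ereal (?u\<^sup>2 * a) + ereal (?u\<^sup>2 * b))"
        by (simp add: s_def algebra_simps)
      also have "\<dots> \<le> norm_sq \<phi>" unfolding dec by (intro add_left_mono add_mono br a b)
      finally show ?thesis .
    qed
  qed
  then show ?thesis using upper e by (simp add: s_def)
qed

lemma cap_join:
  assumes "\<And>c. F c \<subseteq> boundary" "cap (F True) = ereal a" "cap (F False) = ereal b"
  shows "cap (join F) = ereal ((a + b) / (1 + (a + b)))"
  by (rule cap_branches) (simp_all add: assms join_subset)

section \<open>The capacity of the whole boundary\<close>

lemma norm_sq_append:
  "norm_sq (\<lambda>y. \<phi> (x @ y)) = ereal ((\<phi> x)\<^sup>2) +
    (norm_sq (\<lambda>y. \<phi> ((x @ [True]) @ y)) + norm_sq (\<lambda>y. \<phi> ((x @ [False]) @ y)))"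
  using norm_sq_glue[of "\<phi> x" "\<lambda>b y. \<phi> (x @ b # y)"] glue_eta[of "\<lambda>y. \<phi> (x @ y)"] by simp

text \<open>The greedy geodesic always enters the child whose subtree carries less of the norm, so the
  weight at its \<open>k\<close>-th vertex is at most \<open>(r / 2 ^ k)\<close> to the power \<open>1 / 2\<close>; since
  \<open>1 / 2 \<le> (3 / 4)\<^sup>2\<close>, a geometric series bounds the path sum.\<close>

lemma exists_small_path_sum:
  assumes nn: "\<And>x. 0 \<le> \<phi> x" and r: "norm_sq \<phi> = ereal r"
  shows "\<exists>\<zeta>\<in>boundary. path_sum \<phi> (bpath \<zeta>) \<le> ereal (4 * sqrt r)"
proof -
  define N where "N x = norm_sq (\<lambda>y. \<phi> (x @ y))" for x
  have N: "N x = ereal ((\<phi> x)\<^sup>2) + (N (x @ [True]) + N (x @ [False]))" for x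
    unfolding N_def by (rule norm_sq_append)
  have N0: "0 \<le> N x" for x by (simp add: N_def)
  have r0: "0 \<le> r" using norm_sq_nonneg[of \<phi>] r by simp
  define \<zeta> where "\<zeta> = rec_nat [] (\<lambda>_ x. x @ [N (x @ [True]) \<le> N (x @ [False])])"
  have \<zeta>: "\<zeta> 0 = []" "\<zeta> (Suc k) = \<zeta> k @ [N (\<zeta> k @ [True]) \<le> N (\<zeta> k @ [False])]" for k
    by (simp_all add: \<zeta>_def)
  have bd: "\<zeta> \<in> boundary" by (auto simp: boundary_def \<zeta>)
  have Nk: "N (\<zeta> k) \<le> ereal (r / 2 ^ k)" for k
  proof (induction k)
    case 0
    show ?case by (simp add: \<zeta> N_def r)
  next
    case (Suc k)
    let ?x = "\<zeta> k"
    have le: "ereal ((\<phi> ?x)\<^sup>2) + (N (?x @ [True]) + N (?x @ [False])) \<le> ereal (r / 2 ^ k)"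
      using Suc.IH unfolding N[of ?x] .
    \<comment> \<open>Both halves are finite, being nonnegative with a finite bound on their sum,
      and the smaller one is at most half of that bound.\<close>
    have "N (?x @ [N (?x @ [True]) \<le> N (?x @ [False])]) \<le> ereal (r / 2 ^ k / 2)"
    proof -
      obtain p q where pq: "N (?x @ [True]) = ereal p" "N (?x @ [False]) = ereal q"
        using le N0[of "?x @ [True]"] N0[of "?x @ [False]"]
        by (cases "N (?x @ [True])"; cases "N (?x @ [False])") auto
      then have "(\<phi> ?x)\<^sup>2 + (p + q) \<le> r / 2 ^ k" using le by simp
      moreover have "0 \<le> (\<phi> ?x)\<^sup>2" by simp
      ultimately have "p + q \<le> r / 2 ^ k" by linarith
      then have "(if p \<le> q then p else q) \<le> r / 2 ^ k / 2" by auto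
      then show ?thesis using pq by (cases "p \<le> q") auto
    qed
    then show ?case by (simp add: \<zeta> mult.commute)
  qed
  have \<phi>k: "\<phi> (\<zeta> k) \<le> sqrt r * (3/4) ^ k" for k
  proof (rule power2_le_imp_le)
    have "ereal ((\<phi> (\<zeta> k))\<^sup>2) \<le> N (\<zeta> k)"
      unfolding N[of "\<zeta> k"] using N0 by (simp add: ereal_le_add_self)
    then have "(\<phi> (\<zeta> k))\<^sup>2 \<le> r / 2 ^ k" using Nk[of k] by (metis ereal_less_eq(3) order_trans)
    also have "\<dots> = r * (1/2) ^ k" by (simp add: power_one_over field_simps)
    also have "\<dots> \<le> r * (9/16) ^ k" using r0 by (intro mult_left_mono power_mono) auto
    also have "\<dots> = (sqrt r * (3/4) ^ k)\<^sup>2"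
    proof -
      have "((3/4) ^ k)\<^sup>2 = (9/16 :: real) ^ k"
        by (simp add: power2_eq_square flip: power_mult_distrib)
      then show ?thesis using r0 by (simp add: power_mult_distrib)
    qed
    finally show "(\<phi> (\<zeta> k))\<^sup>2 \<le> (sqrt r * (3/4) ^ k)\<^sup>2" .
  qed (use r0 in simp)
  have inj: "inj \<zeta>" using boundary_level[OF bd] by (metis injI)
  have "path_sum \<phi> (bpath \<zeta>) = (\<Sum>\<^sub>\<infinity>k. ereal (\<phi> (\<zeta> k)))"
    unfolding path_sum_def bpath_def using inj by (simp add: infsum_reindex o_def)
  also have "\<dots> \<le> ereal (4 * sqrt r)"
  proof (rule infsum_le_finite_sums)
    show "(\<lambda>k. ereal (\<phi> (\<zeta> k))) summable_on UNIV"
      by (rule nonneg_summable_on_complete) (simp add: nn)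
    fix F :: "nat set" assume F: "finite F"
    have sm: "summable (\<lambda>k. (3/4::real) ^ k)" by (simp add: summable_geometric)
    have "(\<Sum>k\<in>F. \<phi> (\<zeta> k)) \<le> (\<Sum>k\<in>F. sqrt r * (3/4) ^ k)" by (rule sum_mono) (rule \<phi>k)
    also have "\<dots> = sqrt r * (\<Sum>k\<in>F. (3/4) ^ k)" by (simp add: sum_distrib_left)
    also have "\<dots> \<le> sqrt r * (\<Sum>k. (3/4) ^ k)"
      using r0 sm F by (intro mult_left_mono sum_le_suminf) auto
    also have "\<dots> = 4 * sqrt r" by (simp add: suminf_geometric)
    finally show "(\<Sum>k\<in>F. ereal (\<phi> (\<zeta> k))) \<le> ereal (4 * sqrt r)" by simp
  qed
  finally show ?thesis using bd by blast
qed

text \<open>Both branches of \<open>boundary\<close> are \<open>boundary\<close> again, so its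
  capacity \<open>c\<close> solves \<open>c = 2 * c / (1 + 2 * c)\<close>, with roots 0 and
  \<open>1 / 2\<close>. The root 0 is excluded because a weight of norm square \<open>r\<close> has
  a geodesic with sum at most \<open>4 * sqrt r\<close>, whence \<open>r \<ge> 1 / 16\<close> for
  admissible weights.\<close>

lemma cap_boundary: "cap boundary = ereal (1 / 2)"
proof -
  obtain c where c: "cap boundary = ereal c" "0 \<le> c" using cap_finite[of boundary] by blast
  have "ereal (1/16) \<le> cap boundary"
    unfolding cap_eq_INF
  proof (rule INF_greatest)
    fix \<phi> assume \<phi>: "\<phi> \<in> adm 0 boundary"
    show "ereal (1/16) \<le> norm_sq \<phi>"
    proof (cases "norm_sq \<phi>")
      case (real r)
      obtain \<zeta> where "\<zeta> \<in> boundary" "path_sum \<phi> (bpath \<zeta>) \<le> ereal (4 * sqrt r)"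
        using exists_small_path_sum[of \<phi> r] real \<phi> by (auto simp: adm_def)
      moreover from this have "1 \<le> path_sum \<phi> (bpath \<zeta>)" using \<phi> by (simp add: adm_def)
      ultimately have "1 \<le> ereal (4 * sqrt r)" by (blast intro: order_trans)
      then have "1/4 \<le> sqrt r" by (simp add: one_ereal_def)
      then have "(1/4)\<^sup>2 \<le> (sqrt r)\<^sup>2" by (rule power_mono) simp
      then have "(1/4)\<^sup>2 \<le> r" using norm_sq_nonneg[of \<phi>] real by simp
      then show ?thesis by (simp add: real power2_eq_square)
    qed (use norm_sq_nonneg[of \<phi>] in auto)
  qed
  then have pos: "c > 0" using c by simp
  have "c = (c + c) / (1 + (c + c))"
    using cap_branches[of boundary c c] c by simp
  then have "c * (1 + 2 * c) = 2 * c" using pos by (simp add: field_simps)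
  then have "1 + 2 * c = 2" using pos by simp
  then show ?thesis using c by simp
qed

lemma cap_real:
  assumes "E \<subseteq> boundary"
  obtains c where "cap E = ereal c" "0 \<le> c" "c \<le> 1 / 2"
  using cap_finite[OF assms] cap_mono[OF assms] unfolding cap_boundary by force

section \<open>Closed sets of prescribed capacity\<close>

text \<open>A comb along the all-\<open>True\<close> geodesic: the full subtree hanging off it at
  level \<open>k\<close> is kept iff \<open>\<beta> k\<close>. The geodesic itself always belongs to
  the set, so limits of ever later teeth are included.\<close>

definition spiral :: "(nat \<Rightarrow> bool) \<Rightarrow> (nat \<Rightarrow> vertex) set" where
  "spiral \<beta> = {\<xi>\<in>boundary. \<forall>k. \<xi> (Suc k) = replicate k True @ [False] \<longrightarrow> \<beta> k}"

lemma bclosed_spiral: "bclosed (spiral \<beta>)"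
  unfolding bclosed_iff by (auto simp: spiral_def) metis

lemma branch_True_spiral: "branch True (spiral \<beta>) = spiral (\<lambda>k. \<beta> (Suc k))"
proof -
  have "(\<forall>k. True # \<zeta> k = replicate k True @ [False] \<longrightarrow> \<beta> k) \<longleftrightarrow>
      (\<forall>k. \<zeta> (Suc k) = replicate k True @ [False] \<longrightarrow> \<beta> (Suc k))" 
    (is "?L \<longleftrightarrow> ?R") for \<zeta> :: "nat \<Rightarrow> vertex"
  proof
    assume ?L
    then show ?R by (metis append_Cons replicate_Suc)
  next
    assume R: ?R
    show ?L
    proof (intro allI impI)
      fix k assume "True # \<zeta> k = replicate k True @ [False]"
      then show "\<beta> k" using R by (cases k) auto
    qed
  qed
  then show ?thesis by (auto simp: branch_def spiral_def)
qed

lemma branch_False_spiral: "branch False (spiral \<beta>) = (if \<beta> 0 then boundary else {})"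
proof -
  have "(\<forall>k. False # \<zeta> k = replicate k True @ [False] \<longrightarrow> \<beta> k) \<longleftrightarrow> \<beta> 0"
    if "\<zeta> \<in> boundary" for \<zeta> :: "nat \<Rightarrow> vertex"
  proof -
    have z: "\<zeta> 0 = []" using that by (simp add: boundary_def)
    have "False # \<zeta> k = replicate k True @ [False] \<longleftrightarrow> k = 0" for k
      by (cases k) (auto simp: z)
    then show ?thesis by auto
  qed
  then show ?thesis by (auto simp: branch_def spiral_def)
qed

text \<open>The difference of the fractions is \<open>(x - y) / ((1 + x) * (1 + y))\<close>, and for
  nonnegative \<open>x\<close>, \<open>y\<close> this denominator is at least
  \<open>1 + \<bar>x - y\<bar>\<close>. It remains to use that \<open>e / (1 + e)\<close> increases
  with \<open>e\<close>.\<close>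

lemma diff_frac_le:
  fixes x y :: real
  assumes "0 \<le> x" "0 \<le> y" "\<bar>x - y\<bar> \<le> d"
  shows "\<bar>x / (1 + x) - y / (1 + y)\<bar> \<le> d / (1 + d)"
proof -
  define e where "e = \<bar>x - y\<bar>"
  have e: "0 \<le> e" "e \<le> d" using assms by (auto simp: e_def)
  have "x / (1 + x) - y / (1 + y) = (x - y) / ((1 + x) * (1 + y))"
    using assms by (simp add: field_simps)
  then have "\<bar>x / (1 + x) - y / (1 + y)\<bar> = e / ((1 + x) * (1 + y))"
    using assms by (simp add: e_def abs_mult)
  also have "\<dots> \<le> e / (1 + e)"
  proof (rule divide_left_mono)
    have "1 + e \<le> 1 + x + y" using assms by (auto simp: e_def)
    also have "\<dots> \<le> (1 + x) * (1 + y)" using assms by (simp add: algebra_simps)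
    finally show "1 + e \<le> (1 + x) * (1 + y)" .
  qed (use assms e in auto)
  also have "\<dots> \<le> d / (1 + d)"
    using e by (simp add: divide_simps) (simp add: algebra_simps)
  finally show ?thesis .
qed

text \<open>The remainders \<open>r k\<close> are the capacities that the tails of the spiral should have. As the
  recursion of \<open>cap_branches\<close> sends an error \<open>d\<close> to at most \<open>d / (1 + d)\<close>, a bound \<open>1 / (m + 2)\<close>
  on the errors of all tails improves to \<open>1 / (m + 3)\<close>.\<close>

lemma cap_spiral_exists:
  assumes c: "0 \<le> c" "c \<le> 1 / 2"
  obtains \<beta> where "cap (spiral \<beta>) = ereal c"
proof -
  \<comment> \<open>\<open>x / (1 - x)\<close> inverts \<open>s / (1 + s)\<close>, so it is the
    total capacity to be shared by the two branches. If it exceeds \<open>1 / 2\<close>, the most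
    one branch can hold, the \<open>False\<close> branch is taken full with capacity
    \<open>1 / 2\<close>; otherwise it is left empty. The rest goes to the \<open>True\<close>
    branch.\<close>
  define r where "r = rec_nat c (\<lambda>_ x. let s = x / (1 - x) in if s > 1/2 then s - 1/2 else s)"
  define \<beta> where "\<beta> k = (r k / (1 - r k) > 1/2)" for k
  have r0: "r 0 = c" by (simp add: r_def)
  have rS: "r (Suc k) = r k / (1 - r k) - (if \<beta> k then 1/2 else 0)" for k
    by (simp add: r_def \<beta>_def Let_def)
  have rb: "0 \<le> r k \<and> r k \<le> 1/2" for k
  proof (induction k)
    case 0
    show ?case using c by (simp add: r0)
  next
    case (Suc k)
    define s where "s = r k / (1 - r k)"
    have "0 \<le> s" "s \<le> 1" using Suc by (auto simp: s_def divide_simps)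
    moreover have "r (Suc k) = s - (if s > 1/2 then 1/2 else 0)"
      by (simp only: rS \<beta>_def s_def)
    ultimately show ?case by auto
  qed
  define T where "T k = spiral (\<lambda>j. \<beta> (k + j))" for k
  have T: "T k \<subseteq> boundary" for k by (auto simp: T_def spiral_def)
  define \<gamma> where "\<gamma> k = real_of_ereal (cap (T k))" for k
  have \<gamma>: "cap (T k) = ereal (\<gamma> k)" "0 \<le> \<gamma> k" "\<gamma> k \<le> 1/2" for k
    using cap_real[OF T[of k]] by (metis \<gamma>_def real_of_ereal.simps(1))+
  define h where "h k = (if \<beta> k then 1/2 else 0 :: real)" for k
  have \<gamma>S: "\<gamma> k = (\<gamma> (Suc k) + h k) / (1 + (\<gamma> (Suc k) + h k))" for k
  proof -
    have "branch True (T k) = T (Suc k)" by (simp add: T_def branch_True_spiral)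
    then have 1: "cap (branch True (T k)) = ereal (\<gamma> (Suc k))" by (simp add: \<gamma>)
    have 2: "cap (branch False (T k)) = ereal (h k)"
      by (simp add: T_def branch_False_spiral cap_boundary h_def)
    show ?thesis using cap_branches[OF T 1 2] \<gamma>(1)[of k] by simp
  qed
  have rS': "r k = (r (Suc k) + h k) / (1 + (r (Suc k) + h k))" for k
    using rb[of k] by (simp add: rS h_def field_simps)
  \<comment> \<open>The bound for \<open>k\<close> uses the previous bound at \<open>Suc k\<close>,
    so \<open>k\<close> must be arbitrary. The start \<open>m = 0\<close> holds because both numbers
    lie between 0 and \<open>1 / 2\<close>.\<close>
  have err: "\<bar>\<gamma> k - r k\<bar> \<le> 1 / (real m + 2)" for k m
  proof (induction m arbitrary: k)
    case 0
    have "\<bar>\<gamma> k - r k\<bar> \<le> 1 / 2" using \<gamma>(2,3)[of k] rb[of k] by linarith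
    then show ?case by simp
  next
    case (Suc m)
    have "0 \<le> h k" by (simp add: h_def)
    then have "\<bar>\<gamma> k - r k\<bar> \<le> (1 / (real m + 2)) / (1 + 1 / (real m + 2))"
      using diff_frac_le[of "\<gamma> (Suc k) + h k" "r (Suc k) + h k" "1 / (real m + 2)"]
        Suc.IH[of "Suc k"] \<gamma>[of "Suc k"] rb[of "Suc k"] \<gamma>S[of k] rS'[of k] by simp
    also have "\<dots> = 1 / (real (Suc m) + 2)" by (simp add: field_simps)
    finally show ?case .
  qed
  have "\<bar>\<gamma> 0 - r 0\<bar> \<le> 0"
  proof (rule field_le_epsilon)
    fix \<delta> :: real assume "0 < \<delta>"
    then obtain m where m: "inverse (real (Suc m)) < \<delta>" using reals_Archimedean by blast
    have "1 / (real m + 2) \<le> inverse (real (Suc m))" by (simp add: field_simps)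
    then show "\<bar>\<gamma> 0 - r 0\<bar> \<le> 0 + \<delta>" using err[of 0 m] m by linarith
  qed
  then have "cap (spiral \<beta>) = ereal c" using \<gamma>(1)[of 0] by (simp add: T_def r0)
  then show ?thesis by (rule that)
qed

section \<open>The convex profile and the extremal sets\<close>

text \<open>\<open>cap_profile n c\<close> is the value of \<open>cap_level n\<close> on a set of capacity \<open>c\<close> whose \<open>2 ^ n\<close>
  branches at level \<open>n\<close> all have the same capacity.\<close>

definition cap_profile :: "nat \<Rightarrow> real \<Rightarrow> real" where
  "cap_profile n c = c / (1 - (2 - 2 / 2 ^ n) * c)"

lemma cap_profile_0 [simp]: "cap_profile 0 c = c"
  by (simp add: cap_profile_def)

lemma cap_profile_denom_pos:
  fixes c :: real
  assumes "0 \<le> c" "c \<le> 1 / 2"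
  shows "0 < 1 - (2 - 2 / 2 ^ n) * c"
proof -
  have "(2 - 2 / 2 ^ n) * c \<le> (2 - 2 / 2 ^ n) * (1 / 2)"
    using assms by (intro mult_left_mono) (auto simp: field_simps)
  also have "\<dots> < 1" by (simp add: field_simps)
  finally show ?thesis by simp
qed

text \<open>Midpoint convexity of \<open>c / (1 - \<kappa> * c)\<close> for
  \<open>\<kappa> \<ge> 0\<close>: with \<open>p\<close>, \<open>q\<close> the denominators at
  \<open>a\<close>, \<open>b\<close>, the gap between the two sides equals
  \<open>\<kappa> * (a - b)\<^sup>2 / (p * q * (p + q))\<close>.\<close>

lemma cap_profile_midpoint:
  assumes "0 \<le> a" "a \<le> 1 / 2" "0 \<le> b" "b \<le> 1 / 2"
  shows "2 * cap_profile n ((a + b) / 2) \<le> cap_profile n a + cap_profile n b"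
proof -
  define \<kappa> :: real where "\<kappa> = 2 - 2 / 2 ^ n"
  have \<kappa>: "0 \<le> \<kappa>" by (simp add: \<kappa>_def field_simps)
  define p q where "p = 1 - \<kappa> * a" and "q = 1 - \<kappa> * b"
  have pq: "p > 0" "q > 0" using assms cap_profile_denom_pos by (auto simp: p_def q_def \<kappa>_def)
  have m: "1 - \<kappa> * ((a + b) / 2) = (p + q) / 2" by (simp add: p_def q_def algebra_simps)
  have half: "(x / 2) / (y / 2) = x / y" for x y :: real by simp
  have "(a / p + b / q) - 2 * (((a + b) / 2) / ((p + q) / 2)) =
      (a * q + b * p) / (p * q) - 2 * (a + b) / (p + q)"
    unfolding half using pq by (simp add: add_frac_eq)
  also have "\<dots> = ((a * q + b * p) * (p + q) - 2 * (a + b) * (p * q)) / (p * q * (p + q))"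
    using pq by (subst diff_frac_eq) auto
  also have "(a * q + b * p) * (p + q) - 2 * (a + b) * (p * q) = (q - p) * (a * q - b * p)"
    by (simp add: algebra_simps)
  also have "(q - p) * (a * q - b * p) = \<kappa> * (a - b)\<^sup>2"
    by (simp add: p_def q_def algebra_simps power2_eq_square)
  also have "\<kappa> * (a - b)\<^sup>2 / (p * q * (p + q)) \<ge> 0" using \<kappa> pq by simp
  finally have "2 * (((a + b) / 2) / ((p + q) / 2)) \<le> a / p + b / q" by simp
  moreover have "cap_profile n ((a + b) / 2) = ((a + b) / 2) / ((p + q) / 2)"
    by (simp only: cap_profile_def m flip: \<kappa>_def)
  moreover have "cap_profile n a = a / p" "cap_profile n b = b / q"
    by (simp_all only: cap_profile_def p_def q_def \<kappa>_def)
  ultimately show ?thesis by simp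
qed

text \<open>The recursions \<open>cap_branches\<close> and \<open>cap_level_Suc\<close> for two
  branches of equal capacity \<open>m\<close>, expressed through the profile.\<close>

lemma cap_profile_Suc:
  assumes "0 \<le> m"
  shows "cap_profile (Suc n) ((m + m) / (1 + (m + m))) = 2 * cap_profile n m"
proof -
  define u :: real where "u = 2 / 2 ^ n"
  have "cap_profile (Suc n) ((m + m) / (1 + (m + m))) =
      ((m + m) / (1 + (m + m))) / (1 - (2 - u / 2) * ((m + m) / (1 + (m + m))))"
    by (simp add: cap_profile_def u_def)
  also have "1 - (2 - u / 2) * ((m + m) / (1 + (m + m))) = (1 - (2 - u) * m) / (1 + (m + m))"
    using assms by (simp add: field_simps)
  also have "((m + m) / (1 + (m + m))) / \<dots> = 2 * (m / (1 - (2 - u) * m))"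
    using assms by simp
  finally show ?thesis by (simp add: cap_profile_def u_def)
qed

lemma cap_profile_le_cap_level:
  assumes "E \<subseteq> boundary" "cap E = ereal c"
  shows "ereal (cap_profile n c) \<le> cap_level n E"
  using assms
proof (induction n arbitrary: E c)
  case 0
  then show ?case by (simp add: cap_level_def)
next
  case (Suc n)
  obtain a where a: "cap (branch True E) = ereal a" "0 \<le> a" "a \<le> 1/2"
    using cap_real[OF branch_subset] by blast
  obtain b where b: "cap (branch False E) = ereal b" "0 \<le> b" "b \<le> 1/2"
    using cap_real[OF branch_subset] by blast
  \<comment> \<open>The capacity of \<open>E\<close> depends only on \<open>a + b\<close>, so
    replacing both branch capacities by their mean keeps \<open>c\<close> and can only lower the sum
    of the profiles.\<close>
  define m where "m = (a + b) / 2"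
  have m: "0 \<le> m" "a + b = m + m" using a b by (auto simp: m_def)
  have "c = (m + m) / (1 + (m + m))"
    using cap_branches[OF Suc.prems(1) a(1) b(1)] Suc.prems(2) m by simp
  then have "cap_profile (Suc n) c = 2 * cap_profile n m"
    using cap_profile_Suc[OF m(1)] by simp
  also have "\<dots> \<le> cap_profile n a + cap_profile n b"
    unfolding m_def using a b by (intro cap_profile_midpoint)
  finally have "ereal (cap_profile (Suc n) c) \<le> ereal (cap_profile n a) + ereal (cap_profile n b)"
    by simp
  also have "\<dots> \<le> cap_level n (branch True E) + cap_level n (branch False E)"
    by (intro add_mono Suc.IH branch_subset a b)
  finally show ?case using cap_level_Suc[OF Suc.prems(1)] by simp
qed

lemma cap_profile_attained:
  assumes "0 \<le> c" "c \<le> 1 / 2"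
  shows "\<exists>E. bclosed E \<and> cap E = ereal c \<and> cap_level n E = ereal (cap_profile n c)"
  using assms
proof (induction n arbitrary: c)
  case 0
  then obtain \<beta> where "cap (spiral \<beta>) = ereal c" using cap_spiral_exists by blast
  then show ?case using bclosed_spiral by (auto simp: cap_level_def)
next
  case (Suc n)
  \<comment> \<open>This solves \<open>c = 2 * m / (1 + 2 * m)\<close>, so two copies of a set of
    capacity \<open>m\<close> join to one of capacity \<open>c\<close>. It is also the step of
    \<open>eseq\<close>.\<close>
  define m where "m = c / (2 - 2 * c)"
  have m: "0 \<le> m" "m \<le> 1/2" using Suc.prems by (auto simp: m_def field_simps)
  have "c / (2 * q) + c / (2 * q) = c / q" for q by simp
  from this[of "1 - c"] have mm: "m + m = c / (1 - c)" by (simp add: m_def)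
  have "1 + c / (1 - c) = 1 / (1 - c)" using Suc.prems by (simp add: field_simps)
  then have c: "c = (m + m) / (1 + (m + m))" unfolding mm using Suc.prems by simp
  obtain E where E: "bclosed E" "cap E = ereal m" "cap_level n E = ereal (cap_profile n m)"
    using Suc.IH[OF m] by blast
  let ?J = "join (\<lambda>_. E)"
  have J: "bclosed ?J" using E(1) by (rule bclosed_join)
  moreover have "cap ?J = ereal c" unfolding c by (intro cap_join bclosed_subset E)
  moreover have "cap_level (Suc n) ?J = ereal (cap_profile (Suc n) c)"
    using cap_level_Suc[OF bclosed_subset[OF J], of n] bclosed_subset[OF E(1)]
      cap_profile_Suc[OF m(1), of n] by (simp add: E c)
  ultimately show ?case by blast
qed

section \<open>The sequence in closed form and the infimum\<close>

text \<open>\<open>eseq \<epsilon> n\<close> is the capacity of each of the \<open>2 ^ n\<close>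
  equal branches at level \<open>n\<close> of an extremal set.\<close>

lemma eseq_eq_cap_profile:
  assumes "0 \<le> \<epsilon>" "\<epsilon> \<le> 1 / 2"
  shows "2 ^ n * eseq \<epsilon> n = cap_profile n \<epsilon>"
proof (induction n)
  case 0
  show ?case by simp
next
  case (Suc n)
  define p :: real where "p = 2 ^ n"
  define D where "D = 1 - (2 - 2 / p) * \<epsilon>"
  have p: "p > 0" by (simp add: p_def)
  have D: "D > 0" using cap_profile_denom_pos[OF assms, of n] by (simp add: D_def p_def)
  \<comment> \<open>Raising \<open>n\<close> by one halves \<open>2 / p\<close>, which lowers the
    denominator by \<open>\<epsilon> / p\<close>. In the step of \<open>eseq\<close> the old
    denominator \<open>D\<close> then cancels.\<close>
  have D': "1 - (2 - 2 / 2 ^ Suc n) * \<epsilon> = D - \<epsilon> / p"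
    using p by (simp add: D_def p_def field_simps)
  then have pos: "D - \<epsilon> / p > 0" using cap_profile_denom_pos[OF assms, of "Suc n"] by simp
  have "p * eseq \<epsilon> n = \<epsilon> / D" using Suc.IH by (simp add: p_def D_def cap_profile_def)
  then have "eseq \<epsilon> n = \<epsilon> / D / p" using p by (metis nonzero_mult_div_cancel_left less_irrefl)
  then have e: "eseq \<epsilon> n = (\<epsilon> / p) / D" by (simp add: mult.commute)
  have "2 - 2 * eseq \<epsilon> n = 2 * (D - \<epsilon> / p) / D" using D by (simp add: e field_simps)
  then have "eseq \<epsilon> (Suc n) = (\<epsilon> / p) / (2 * (D - \<epsilon> / p))" using D by (simp add: e)
  then have "2 ^ Suc n * eseq \<epsilon> (Suc n) = 2 * p * ((\<epsilon> / p) / (2 * (D - \<epsilon> / p)))"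
    by (simp add: p_def)
  also have "2 * p * ((\<epsilon> / p) / (2 * x)) = \<epsilon> / x" for x using p by simp
  finally show ?case unfolding cap_profile_def D' .
qed

theorem theorem5:
  fixes n :: nat and \<epsilon> :: real
  assumes "\<exists>E\<^sub>0. bclosed E\<^sub>0 \<and> cap E\<^sub>0 = ereal \<epsilon>"
  shows "(INF E \<in> {E. bclosed E \<and> cap E = ereal \<epsilon>}. cap_level n E) = ereal (2 ^ n * eseq \<epsilon> n) \<and>
         2 ^ n * eseq \<epsilon> n = \<epsilon> / (1 - (2 - 2 powi (1 - int n)) * \<epsilon>)"
proof -
  obtain E\<^sub>0 where E0: "bclosed E\<^sub>0" "cap E\<^sub>0 = ereal \<epsilon>" using assms by blast
  have \<epsilon>: "0 \<le> \<epsilon>" "\<epsilon> \<le> 1/2"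
    using cap_real[OF bclosed_subset[OF E0(1)]] E0(2) by force+
  obtain E where E: "bclosed E" "cap E = ereal \<epsilon>" "cap_level n E = ereal (cap_profile n \<epsilon>)"
    using cap_profile_attained[OF \<epsilon>] by blast
  have "(INF E \<in> {E. bclosed E \<and> cap E = ereal \<epsilon>}. cap_level n E) = ereal (cap_profile n \<epsilon>)"
  proof (rule antisym)
    show "(INF E \<in> {E. bclosed E \<and> cap E = ereal \<epsilon>}. cap_level n E) \<le> ereal (cap_profile n \<epsilon>)"
      unfolding E(3)[symmetric] by (rule INF_lower) (simp add: E)
    show "ereal (cap_profile n \<epsilon>) \<le> (INF E \<in> {E. bclosed E \<and> cap E = ereal \<epsilon>}. cap_level n E)"
      by (rule INF_greatest) (use cap_profile_le_cap_level bclosed_subset in blast)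
  qed
  \<comment> \<open>The exponent is negative for \<open>n > 1\<close>, hence the integer power in
    the statement and its translation to the form used by \<open>cap_profile\<close>.\<close>
  moreover have "2 powi (1 - int n) = (2 / 2 ^ n :: real)"
    by (simp add: power_int_diff)
  ultimately show ?thesis using eseq_eq_cap_profile[OF \<epsilon>] by (simp add: cap_profile_def)
qed

end
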